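(* Let $K=\mathbb{F}_q$ be a finite field, let $v_1,\ldots,v_n$ be positive integers, and let $X\subset\mathbb{P}^{n-1}$ be the degenerate projective torus parameterized by $x_1^{v_1},\ldots,x_n^{v_n}$, with vanishing ideal $I(X)\subset S=K[t_1,\ldots,t_n]$. Let $\beta$ be a generator of the cyclic group $K^*$, let $d_i$ be the order of $\beta^{v_i}$ in $K^*$, and let $P\subset S$ be the toric ideal of $K[y_1^{d_1},\ldots,y_1^{d_n}]$. Let $\psi\colon\mathbb{Z}^n\to\mathbb{Z}$ and $D\colon\mathbb{Z}^n\to\mathbb{Z}^n$ be the homomorphisms given by $\psi(e_i)=d_i$ and $D(e_i)=d_ie_i$, and set $\mathcal{L}_1=\ker(\psi)$ and $\mathcal{L}=D(\ker(\psi))$. Then $P=I(\mathcal{L}_1)$ and $I(X)=I(\mathcal{L})$.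
   Context: $X=\{[(x_1^{v_1},\ldots,x_n^{v_n})] : x_i\in K^*\text{ for all }i\}\subset\mathbb{P}^{n-1}$, where $\mathbb{P}^{n-1}$ is the projective space over $K$ and $K^*=K\setminus\{0\}$. $S=K[t_1,\ldots,t_n]$ has the standard grading, and $I(X)$ is the ideal of $S$ generated by the homogeneous polynomials that vanish at all points of $X$. The toric ideal $P$ is the kernel of the $K$-algebra epimorphism $S\to K[y_1^{d_1},\ldots,y_1^{d_n}]\subset K[y_1]$, $t_i\mapsto y_1^{d_i}$, where $K[y_1]$ is a polynomial ring in one variable. $e_1,\ldots,e_n$ is the canonical basis of $\mathbb{Z}^n$. For $a\in\mathbb{N}^n$, $t^a=t_1^{a_1}\cdots t_n^{a_n}$. Any $c\in\mathbb{Z}^n$ is written uniquely as $c=c^+-c^-$ with $c^+,c^-\in\mathbb{N}^n$ of disjoint support. For a lattice (subgroup) $\mathcal{M}\subset\mathbb{Z}^n$, its lattice ideal is $I(\mathcal{M})=(\{t^{\alpha^+}-t^{\alpha^-} : \alpha\in\mathcal{M}\})\subset S$. *)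

theory Defs
  imports
    "HOL-Analysis.Finite_Cartesian_Product"
    "HOL-Library.Poly_Mapping"
    "HOL-Computational_Algebra.Polynomial"
    "HOL-Algebra.Generated_Groups"
    "HOL-Algebra.Multiplicative_Group"
    "HOL-Algebra.Algebraic_Closure_Type"
begin

text \<open>
  The variables \<open>t_1, ..., t_n\<close> are indexed by a finite type \<open>'n\<close>. An exponent
  \<open>a \<in> \<nat>\<^sup>n\<close> is a \<open>'n \<Rightarrow>\<^sub>0 nat\<close>, and a polynomial maps exponents to coefficients; the ring
  structure on \<open>('n, 'a) mpol\<close> is the convolution product of \<open>Poly_Mapping\<close>.
\<close>

type_synonym ('n, 'a) mpol = "('n \<Rightarrow>\<^sub>0 nat) \<Rightarrow>\<^sub>0 'a"

definition monomial :: "('n::finite \<Rightarrow>\<^sub>0 nat) \<Rightarrow> ('n, 'a::comm_ring_1) mpol" where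
  "monomial a = Poly_Mapping.single a 1"

definition homogeneous :: "('n::finite, 'a::comm_ring_1) mpol \<Rightarrow> bool" where
  "homogeneous f \<longleftrightarrow>
     (\<exists>k. \<forall>a \<in> Poly_Mapping.keys f. (\<Sum>i\<in>UNIV. Poly_Mapping.lookup a i) = k)"

text \<open>
  The evaluation \<open>t_i \<mapsto> g i\<close>, with coefficients mapped by \<open>h\<close>. For a ring homomorphism \<open>h\<close>
  it is the unique ring homomorphism that extends \<open>h\<close> and sends \<open>t_i\<close> to \<open>g i\<close>.
\<close>

definition eval_mpol ::
  "('a::comm_ring_1 \<Rightarrow> 'b::comm_ring_1) \<Rightarrow> ('n::finite \<Rightarrow> 'b) \<Rightarrow> ('n, 'a) mpol \<Rightarrow> 'b" where
  "eval_mpol h g f =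
     (\<Sum>a\<in>Poly_Mapping.keys f.
        h (Poly_Mapping.lookup f a) * (\<Prod>i\<in>UNIV. g i ^ Poly_Mapping.lookup a i))"

text \<open>A ring is a module over itself, and the submodule spanned by a set is the ideal it generates.\<close>

definition ideal_gen :: "'r::comm_ring_1 set \<Rightarrow> 'r set" where
  "ideal_gen G = Modules.module.span (*) G"

lemma module_self: "Modules.module ((*) :: 'r::comm_ring_1 \<Rightarrow> 'r \<Rightarrow> 'r)"
  by unfold_locales (auto simp: algebra_simps)

definition proj_rel :: "('a::field ^ 'n::finite) rel" where
  "proj_rel = {(x, y). x \<noteq> 0 \<and> y \<noteq> 0 \<and> (\<exists>c. c \<noteq> 0 \<and> y = c *s x)}"

definition proj_space :: "('a::field ^ 'n::finite) set set" where
  "proj_space = (UNIV - {0}) // proj_rel"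

definition proj_point :: "'a::field ^ 'n::finite \<Rightarrow> ('a ^ 'n) set" where
  "proj_point x = proj_rel `` {x}"

definition proj_torus :: "('n::finite \<Rightarrow> nat) \<Rightarrow> ('a::field ^ 'n) set set" where
  "proj_torus v = {proj_point (\<chi> i. x i ^ v i) | x. \<forall>i. x i \<noteq> 0}"

text \<open>
  A point is an equivalence class of vectors. For homogeneous \<open>f\<close>, vanishing at one
  representative is the same as vanishing at all of them.
\<close>

definition vanishes_at :: "('n::finite, 'a::field) mpol \<Rightarrow> ('a ^ 'n) set \<Rightarrow> bool" where
  "vanishes_at f p \<longleftrightarrow> (\<forall>x\<in>p. eval_mpol (\<lambda>c. c) (\<lambda>i. x $ i) f = 0)"

definition vanishing_ideal :: "('a::field ^ 'n::finite) set set \<Rightarrow> ('n, 'a) mpol set" where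
  "vanishing_ideal Y = ideal_gen {f. homogeneous f \<and> (\<forall>p\<in>Y. vanishes_at f p)}"

definition toric_ideal :: "('n::finite \<Rightarrow> nat) \<Rightarrow> ('n, 'a::field) mpol set" where
  "toric_ideal d =
     {f. eval_mpol (\<lambda>c. [:c:]) (\<lambda>i. Polynomial.monom 1 (d i)) f = (0 :: 'a poly)}"

definition pos_part :: "int ^ 'n::finite \<Rightarrow> ('n \<Rightarrow>\<^sub>0 nat)" where
  "pos_part c = Abs_poly_mapping (\<lambda>i. nat (c $ i))"

definition neg_part :: "int ^ 'n::finite \<Rightarrow> ('n \<Rightarrow>\<^sub>0 nat)" where
  "neg_part c = Abs_poly_mapping (\<lambda>i. nat (- (c $ i)))"

definition lattice_ideal :: "(int ^ 'n::finite) set \<Rightarrow> ('n, 'a::comm_ring_1) mpol set" where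
  "lattice_ideal M = ideal_gen {monomial (pos_part c) - monomial (neg_part c) | c. c \<in> M}"

abbreviation units_group :: "'a::field monoid" where
  "units_group \<equiv> mult_of ring_of_type_algebra"


lemma lookup_pos_part: "Poly_Mapping.lookup (pos_part c) i = nat (c $ i)"
  by (simp add: pos_part_def)

lemma lookup_neg_part: "Poly_Mapping.lookup (neg_part c) i = nat (- (c $ i))"
  by (simp add: neg_part_def)

lemma equiv_proj_rel: "equiv (UNIV - {0}) (proj_rel :: ('a::field ^ 'n::finite) rel)"
proof (rule equivI)
  show "(proj_rel :: ('a ^ 'n) rel) \<subseteq> (UNIV - {0}) \<times> (UNIV - {0})"
    by (auto simp: proj_rel_def)
  show "refl_on (UNIV - {0}) (proj_rel :: ('a ^ 'n) rel)"
    by (auto simp: refl_on_def proj_rel_def intro!: exI[of _ 1])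
  show "sym (proj_rel :: ('a ^ 'n) rel)"
    by (auto simp: sym_def proj_rel_def vec_eq_iff) (metis nonzero_divide_eq_eq divide_eq_0_iff mult.commute one_neq_zero times_divide_eq_left mult_1 nonzero_eq_divide_eq)
  show "trans (proj_rel :: ('a ^ 'n) rel)"
    by (auto simp: trans_def proj_rel_def vec_eq_iff) (metis mult.assoc mult_eq_0_iff)
qed

lemma proj_torus_subset:
  "(proj_torus v :: ('a::field ^ 'n::finite) set set) \<subseteq> proj_space"
  by (auto simp: proj_torus_def proj_space_def proj_point_def vec_eq_iff intro!: quotientI)

lemma eval_mpol_single:
  assumes "h 0 = 0"
  shows "eval_mpol h g (Poly_Mapping.single a c) =
           h c * (\<Prod>i\<in>UNIV. g i ^ Poly_Mapping.lookup a i)"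
  using assms by (simp add: eval_mpol_def)

lemma eval_mpol_plus:
  assumes "h 0 = 0" "\<And>x y. h (x + y) = h x + h y"
  shows "eval_mpol h g (f1 + f2) = eval_mpol h g f1 + eval_mpol h g f2"
proof -
  let ?A = "Poly_Mapping.keys f1 \<union> Poly_Mapping.keys f2"
  have E: "eval_mpol h g f = (\<Sum>a\<in>?A. h (Poly_Mapping.lookup f a) *
      (\<Prod>i\<in>UNIV. g i ^ Poly_Mapping.lookup a i))"
    if "Poly_Mapping.keys f \<subseteq> ?A" for f
    unfolding eval_mpol_def using that
    by (intro sum.mono_neutral_left) (auto simp: assms in_keys_iff)
  show ?thesis
    by (subst (1 2 3) E) (auto simp: Poly_Mapping.keys_add[THEN subsetD] lookup_add assms
        sum.distrib algebra_simps dest: subsetD[OF Poly_Mapping.keys_add])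
qed

lemma mpol_induct [case_names zero add]:
  fixes f :: "('n, 'a::comm_ring_1) mpol"
  assumes "P 0" and "\<And>a c f. P f \<Longrightarrow> P (Poly_Mapping.single a c + f)"
  shows "P f"
proof (induction "card (Poly_Mapping.keys f)" arbitrary: f)
  case 0
  then show ?case using assms(1) by simp
next
  case (Suc k)
  then obtain a where a: "a \<in> Poly_Mapping.keys f"
    by fastforce
  let ?r = "f - Poly_Mapping.single a (Poly_Mapping.lookup f a)"
  have "Poly_Mapping.keys ?r = Poly_Mapping.keys f - {a}"
    by (auto simp: in_keys_iff lookup_minus lookup_single when_def split: if_splits)
  then have "card (Poly_Mapping.keys ?r) = k"
    using a Suc.hyps(2) by simp
  then have "P ?r" using Suc.hyps(1) by metis
  then have "P (Poly_Mapping.single a (Poly_Mapping.lookup f a) + ?r)" by (rule assms(2))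
  then show ?case by simp
qed

lemma eval_mpol_times:
  assumes h: "h 0 = 0" "\<And>x y. h (x + y) = h x + h y" "\<And>x y. h (x * y) = h x * h y"
  shows "eval_mpol h g (f1 * f2) = eval_mpol h g f1 * eval_mpol h g f2"
proof (induction f1 rule: mpol_induct)
  case zero
  then show ?case by (simp add: eval_mpol_def)
next
  case (add a c f1)
  have "eval_mpol h g (Poly_Mapping.single a c * f2) =
          eval_mpol h g (Poly_Mapping.single a c) * eval_mpol h g f2"
  proof (induction f2 rule: mpol_induct)
    case zero
    then show ?case by (simp add: eval_mpol_def)
  next
    case (add b e f2)
    then show ?case
      by (simp add: distrib_left eval_mpol_plus[OF h(1,2)] mult_single eval_mpol_single[of h, OF h(1)]
          h(3) lookup_add power_add prod.distrib mult_ac)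
  qed
  with add show ?case
    by (simp add: distrib_right eval_mpol_plus[OF h(1,2)])
qed

end

theory Submission
  imports Defs "HOL-Number_Theory.Residues"
begin

text \<open>
  Both equalities follow from one criterion: if a map \<open>\<phi>\<close> on exponents satisfies
  \<open>\<phi> a = \<phi> b \<Longrightarrow> a - b \<in> M\<close>, then a polynomial whose coefficients sum to zero over every
  fibre of \<open>\<phi>\<close> is a combination of binomials \<open>t\<^sup>a - t\<^sup>b\<close> with \<open>a - b \<in> M\<close>, hence lies in \<open>I(M)\<close>.
  For \<open>P\<close> the fibres are those of the weight \<open>a \<mapsto> \<Sum>i. d\<^sub>i a\<^sub>i\<close>, and the sums are the coefficients of
  the image in \<open>K[y\<^sub>1]\<close>. For \<open>I(X)\<close> the fibres are the classes of exponents modulo \<open>d\<close>; the sums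
  vanish by orthogonality of the characters of \<open>\<Prod>i. \<langle>\<beta>^v\<^sub>i\<rangle>\<close>, and two exponents of equal degree
  that agree modulo \<open>d\<close> differ by an element of \<open>D(ker \<psi>)\<close>.
\<close>

section \<open>Generated ideals and lattice ideals\<close>

lemma ideal_gen_base: "x \<in> G \<Longrightarrow> x \<in> ideal_gen G"
  unfolding ideal_gen_def by (rule module.span_base[OF module_self])

lemma ideal_gen_mult: "x \<in> ideal_gen G \<Longrightarrow> c * x \<in> ideal_gen G"
  unfolding ideal_gen_def by (rule module.span_scale[OF module_self])

lemma ideal_gen_sum: "(\<And>x. x \<in> A \<Longrightarrow> f x \<in> ideal_gen G) \<Longrightarrow> sum f A \<in> ideal_gen G"
  unfolding ideal_gen_def by (rule module.span_sum[OF module_self])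

lemma ideal_gen_minimal:
  assumes "G \<subseteq> T" "0 \<in> T" "\<And>x y. x \<in> T \<Longrightarrow> y \<in> T \<Longrightarrow> x + y \<in> T" "\<And>c x. x \<in> T \<Longrightarrow> c * x \<in> T"
  shows "ideal_gen G \<subseteq> T"
  unfolding ideal_gen_def
  by (intro module.span_minimal[OF module_self] module.subspaceI[OF module_self] assms)

lemma ideal_gen_subset: "G \<subseteq> ideal_gen H \<Longrightarrow> ideal_gen G \<subseteq> ideal_gen H"
  unfolding ideal_gen_def
  by (intro module.span_minimal[OF module_self] module.subspace_span[OF module_self])

lemma monomial_add: "monomial (a + b) = monomial a * monomial b"
  by (simp add: monomial_def mult_single)

lemma binomial_in_lattice_ideal:
  fixes a b :: "'n::finite \<Rightarrow>\<^sub>0 nat"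
  assumes "(\<chi> i. int (Poly_Mapping.lookup a i) - int (Poly_Mapping.lookup b i)) \<in> M"
  shows "(monomial a - monomial b :: ('n, 'a::comm_ring_1) mpol) \<in> lattice_ideal M"
proof -
  define c :: "int ^ 'n" where "c = (\<chi> i. int (Poly_Mapping.lookup a i) - int (Poly_Mapping.lookup b i))"
  \<comment> \<open>\<open>m\<close> is the componentwise minimum of \<open>a\<close> and
    \<open>b\<close>; factoring out its monomial leaves two monomials of disjoint support.\<close>
  define m where "m = a - pos_part c"
  have "a = m + pos_part c" "b = m + neg_part c"
    by (rule poly_mapping_eqI; simp add: m_def c_def lookup_add lookup_minus lookup_pos_part
        lookup_neg_part; linarith)+
  then have eq: "(monomial a - monomial b :: ('n, 'a) mpol) =
      monomial m * (monomial (pos_part c) - monomial (neg_part c))"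
    by (simp only: monomial_add right_diff_distrib)
  have "c \<in> M" using assms by (simp add: c_def)
  then show ?thesis
    unfolding eq lattice_ideal_def by (intro ideal_gen_mult ideal_gen_base) blast
qed

lemma single_sum: "Poly_Mapping.single a (sum f A) = (\<Sum>x\<in>A. Poly_Mapping.single a (f x))"
  by (induction A rule: infinite_finite_induct) (simp_all add: single_add)

lemma poly_mapping_sum_single:
  "(\<Sum>a\<in>Poly_Mapping.keys f. Poly_Mapping.single a (Poly_Mapping.lookup f a)) = f"
  by (rule poly_mapping_eqI) (simp add: lookup_sum lookup_single when_def in_keys_iff)

text \<open>Moving each term of \<open>f\<close> to a chosen exponent of its fibre gives zero, so
  subtracting the moved terms rewrites \<open>f\<close> as a combination of binomials.
  \<open>diff\<close> concerns only exponents of \<open>f\<close>, which lets homogeneity enter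
  later for \<open>I(X)\<close>.\<close>

lemma fibre_sums_zero_in_lattice_ideal:
  fixes f :: "('n::finite, 'a::comm_ring_1) mpol" and \<phi> :: "('n \<Rightarrow>\<^sub>0 nat) \<Rightarrow> 'c"
  assumes diff: "\<And>a b. a \<in> Poly_Mapping.keys f \<Longrightarrow> b \<in> Poly_Mapping.keys f \<Longrightarrow> \<phi> a = \<phi> b \<Longrightarrow>
      (\<chi> i. int (Poly_Mapping.lookup a i) - int (Poly_Mapping.lookup b i)) \<in> M"
    and zero: "\<And>w. (\<Sum>a | a \<in> Poly_Mapping.keys f \<and> \<phi> a = w. Poly_Mapping.lookup f a) = 0"
  shows "f \<in> lattice_ideal M"
proof -
  define \<rho> where "\<rho> w = inv_into (Poly_Mapping.keys f) \<phi> w" for w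
  have \<rho>: "\<rho> (\<phi> a) \<in> Poly_Mapping.keys f" "\<phi> (\<rho> (\<phi> a)) = \<phi> a" if "a \<in> Poly_Mapping.keys f" for a
    using that unfolding \<rho>_def by (auto intro: inv_into_into f_inv_into_f)
  have "(\<Sum>a\<in>Poly_Mapping.keys f. Poly_Mapping.single (\<rho> (\<phi> a)) (Poly_Mapping.lookup f a)) =
      (\<Sum>w\<in>\<phi> ` Poly_Mapping.keys f. \<Sum>a | a \<in> Poly_Mapping.keys f \<and> \<phi> a = w. Poly_Mapping.single (\<rho> (\<phi> a)) (Poly_Mapping.lookup f a))"
    by (rule sum.image_gen) simp
  also have "\<dots> = (\<Sum>w\<in>\<phi> ` Poly_Mapping.keys f.
      Poly_Mapping.single (\<rho> w) (\<Sum>a | a \<in> Poly_Mapping.keys f \<and> \<phi> a = w. Poly_Mapping.lookup f a))"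
    by (intro sum.cong refl) (simp add: single_sum)
  also have "\<dots> = 0" by (simp add: zero)
  finally have "f = (\<Sum>a\<in>Poly_Mapping.keys f. Poly_Mapping.single a (Poly_Mapping.lookup f a)) -
      (\<Sum>a\<in>Poly_Mapping.keys f. Poly_Mapping.single (\<rho> (\<phi> a)) (Poly_Mapping.lookup f a))"
    by (simp add: poly_mapping_sum_single)
  also have "\<dots> = (\<Sum>a\<in>Poly_Mapping.keys f. Poly_Mapping.single 0 (Poly_Mapping.lookup f a) *
      (monomial a - monomial (\<rho> (\<phi> a))))"
    by (simp add: sum_subtractf right_diff_distrib monomial_def mult_single)
  also have "\<dots> \<in> lattice_ideal M"
    unfolding lattice_ideal_def
    by (intro ideal_gen_sum ideal_gen_mult
        binomial_in_lattice_ideal[unfolded lattice_ideal_def] diff) (auto simp: \<rho>)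
  finally show ?thesis .
qed

section \<open>Evaluation\<close>

lemma eval_mpol_monomial_diff:
  assumes h: "h 0 = 0" "\<And>x y. h (x + y) = h x + h y" "h 1 = 1"
  shows "eval_mpol h g (monomial a - monomial b) =
    (\<Prod>i\<in>UNIV. g i ^ Poly_Mapping.lookup a i) - (\<Prod>i\<in>UNIV. g i ^ Poly_Mapping.lookup b i)"
proof -
  have "eval_mpol h g (monomial a - monomial b) + eval_mpol h g (monomial b) =
      eval_mpol h g (monomial a)"
    by (subst eval_mpol_plus[of h, OF h(1,2), symmetric]) simp
  then show ?thesis
    by (simp add: monomial_def eval_mpol_single[of h, OF h(1)] h(3) algebra_simps)
qed

lemma prod_monom_power:
  "(\<Prod>i\<in>A. Polynomial.monom (1::'a::comm_ring_1) (d i) ^ e i) =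
    Polynomial.monom 1 (\<Sum>i\<in>A. d i * e i)"
  by (induction A rule: infinite_finite_induct) (simp_all add: monom_power mult_monom)

text \<open>The monomials of a generator map to powers of \<open>y\<close> whose exponents differ by
  the weighted sum of \<open>c\<close>, hence to the same power; the kernel of a ring homomorphism
  is an ideal.\<close>

lemma lattice_ideal_subset_toric_ideal:
  fixes d :: "'n::finite \<Rightarrow> nat" and M :: "(int ^ 'n) set"
  assumes "\<And>c. c \<in> M \<Longrightarrow> (\<Sum>i\<in>UNIV. c $ i * int (d i)) = 0"
  shows "(lattice_ideal M :: ('n, 'a::field) mpol set) \<subseteq> toric_ideal d"
  unfolding lattice_ideal_def
proof (rule ideal_gen_minimal)
  show "{monomial (pos_part c) - monomial (neg_part c) |c. c \<in> M}
      \<subseteq> (toric_ideal d :: ('n, 'a) mpol set)"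
  proof clarify
    fix c assume "c \<in> M"
    have "int (\<Sum>i\<in>UNIV. d i * nat (c $ i)) - int (\<Sum>i\<in>UNIV. d i * nat (- (c $ i)))
        = (\<Sum>i\<in>UNIV. c $ i * int (d i))"
      unfolding of_nat_sum sum_subtractf[symmetric]
      by (intro sum.cong refl) (auto simp: max_def algebra_simps)
    then have "(\<Sum>i\<in>UNIV. d i * nat (c $ i)) = (\<Sum>i\<in>UNIV. d i * nat (- (c $ i)))"
      using assms[OF \<open>c \<in> M\<close>] by linarith
    then show "monomial (pos_part c) - monomial (neg_part c) \<in>
        (toric_ideal d :: ('n, 'a) mpol set)"
      by (simp add: toric_ideal_def eval_mpol_monomial_diff one_pCons prod_monom_power
          lookup_pos_part lookup_neg_part)
  qed
qed (auto simp: toric_ideal_def eval_mpol_plus eval_mpol_times, simp add: eval_mpol_def)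

text \<open>Since \<open>t^a\<close> maps to \<open>y^(wt a)\<close>, the coefficient of the image
  at \<open>y^w\<close> collects exactly the fibre of \<open>w\<close>.\<close>

lemma toric_ideal_subset_lattice_ideal:
  fixes d :: "'n::finite \<Rightarrow> nat" and M :: "(int ^ 'n) set"
  assumes "\<And>c. (\<Sum>i\<in>UNIV. c $ i * int (d i)) = 0 \<Longrightarrow> c \<in> M"
  shows "(toric_ideal d :: ('n, 'a::field) mpol set) \<subseteq> lattice_ideal M"
proof
  fix f :: "('n, 'a) mpol" assume "f \<in> toric_ideal d"
  define wt where "wt a = (\<Sum>i\<in>UNIV. d i * Poly_Mapping.lookup a i)" for a :: "'n \<Rightarrow>\<^sub>0 nat"
  have *: "(\<Sum>a\<in>Poly_Mapping.keys f. Polynomial.monom (Poly_Mapping.lookup f a) (wt a)) = 0"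
    using \<open>f \<in> toric_ideal d\<close>
    by (simp add: toric_ideal_def eval_mpol_def prod_monom_power smult_monom wt_def)
  show "f \<in> lattice_ideal M"
  proof (rule fibre_sums_zero_in_lattice_ideal[where \<phi> = wt])
    fix w
    have "(\<Sum>a | a \<in> Poly_Mapping.keys f \<and> wt a = w. Poly_Mapping.lookup f a) =
        (\<Sum>a\<in>Poly_Mapping.keys f. if wt a = w then Poly_Mapping.lookup f a else 0)"
      by (simp add: sum.inter_filter)
    also have "\<dots> = poly.coeff (\<Sum>a\<in>Poly_Mapping.keys f. Polynomial.monom (Poly_Mapping.lookup f a) (wt a)) w"
      by (simp add: coeff_sum)
    finally show "(\<Sum>a | a \<in> Poly_Mapping.keys f \<and> wt a = w. Poly_Mapping.lookup f a) = 0"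
      by (simp add: *)
  next
    fix a b :: "'n \<Rightarrow>\<^sub>0 nat" assume "wt a = wt b"
    then have "int (wt a) - int (wt b) = 0" by simp
    then show "(\<chi> i. int (Poly_Mapping.lookup a i) - int (Poly_Mapping.lookup b i)) \<in> M"
      by (intro assms) (simp add: wt_def sum_subtractf algebra_simps)
  qed
qed

section \<open>Vanishing on the torus\<close>

lemma sum_powers_root_of_unity:
  fixes z :: "'a::field"
  assumes "z ^ d = 1"
  shows "(\<Sum>k<d. z ^ k) = (if z = 1 then of_nat d else 0)"
  using assms geometric_sum[of z d] by auto

text \<open>Modulo \<open>d\<close>, the factor \<open>d - 1\<close> is -1, so a natural exponent
  encodes \<open>l - s\<close>.\<close>

lemma dvd_add_pred_mult_iff:
  fixes d l s :: nat
  assumes "d > 0"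
  shows "d dvd l + (d - 1) * s \<longleftrightarrow> l mod d = s mod d"
proof -
  have "d dvd l + (d - 1) * s \<longleftrightarrow> int d dvd int l + (int d - 1) * int s"
    using assms by (simp flip: int_dvd_int_iff add: of_nat_diff)
  also have "int l + (int d - 1) * int s = (int l - int s) + int d * int s"
    by (simp add: algebra_simps)
  also have "int d dvd \<dots> \<longleftrightarrow> int d dvd int l - int s"
    by (simp add: dvd_add_left_iff)
  also have "\<dots> \<longleftrightarrow> l mod d = s mod d"
    by (simp flip: mod_eq_dvd_iff of_nat_mod)
  finally show ?thesis .
qed

text \<open>
  The exponent \<open>(d i - 1) * s i\<close> below stands for \<open>- s i\<close>: summing \<open>f\<close> against that character
  isolates the class of \<open>s\<close> modulo \<open>d\<close>.
\<close>

lemma residue_class_sums_zero: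
  fixes f :: "('n::finite, 'a::field) mpol" and \<gamma> :: "'n \<Rightarrow> 'a" and s :: "'n \<Rightarrow> nat"
  assumes root: "\<And>i k. \<gamma> i ^ k = 1 \<longleftrightarrow> d i dvd k"
    and nz: "\<And>i. of_nat (d i) \<noteq> (0::'a)"
    and vanish: "\<And>m. eval_mpol (\<lambda>c. c) (\<lambda>i. \<gamma> i ^ m i) f = 0"
  shows "(\<Sum>a | a \<in> Poly_Mapping.keys f \<and> (\<forall>i. Poly_Mapping.lookup a i mod d i = s i mod d i).
      Poly_Mapping.lookup f a) = 0"
proof -
  define e where "e i = (d i - 1) * s i" for i
  \<comment> \<open>As \<open>m\<close> runs through \<open>E\<close>, the tuples
    \<open>\<gamma> i ^ m i\<close> run once through the product of the cyclic groups generated by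
    the \<open>\<gamma> i\<close>.\<close>
  define E where "E = PiE UNIV (\<lambda>i. {..<d i})"
  define S where "S = {a \<in> Poly_Mapping.keys f. \<forall>i. Poly_Mapping.lookup a i mod d i = s i mod d i}"
  have dpos: "d i > 0" for i using nz[of i] by (cases "d i = 0") auto
  have geo: "(\<Sum>k<d i. (\<gamma> i ^ (l + e i)) ^ k) =
      (if l mod d i = s i mod d i then of_nat (d i) else 0)" for i l
  proof -
    have "(\<gamma> i ^ (l + e i)) ^ d i = 1"
      unfolding power_mult[symmetric] root by simp
    then show ?thesis
      using dvd_add_pred_mult_iff[OF dpos, of i l "s i"]
      by (simp add: sum_powers_root_of_unity root e_def)
  qed
  have prod_geo: "(\<Prod>i\<in>UNIV. \<Sum>k<d i. (\<gamma> i ^ (Poly_Mapping.lookup a i + e i)) ^ k) =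
      (if \<forall>i. Poly_Mapping.lookup a i mod d i = s i mod d i then \<Prod>i\<in>UNIV. of_nat (d i) else 0)" for a
    unfolding geo by (auto intro: prod.cong)
  have "0 = (\<Sum>m\<in>E. (\<Prod>i\<in>UNIV. \<gamma> i ^ (m i * e i)) * eval_mpol (\<lambda>c. c) (\<lambda>i. \<gamma> i ^ m i) f)"
    by (simp add: vanish)
  also have "\<dots> = (\<Sum>m\<in>E. \<Sum>a\<in>Poly_Mapping.keys f. Poly_Mapping.lookup f a *
      (\<Prod>i\<in>UNIV. (\<gamma> i ^ (Poly_Mapping.lookup a i + e i)) ^ m i))"
    unfolding eval_mpol_def sum_distrib_left
    by (intro sum.cong refl)
      (simp add: prod.distrib power_add power_mult_distrib mult_ac flip: power_mult)
  also have "\<dots> = (\<Sum>a\<in>Poly_Mapping.keys f. Poly_Mapping.lookup f a *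
      (\<Sum>m\<in>E. \<Prod>i\<in>UNIV. (\<gamma> i ^ (Poly_Mapping.lookup a i + e i)) ^ m i))"
    by (subst sum.swap) (simp add: sum_distrib_left)
  \<comment> \<open>By distributivity the sum over the box factors into one geometric sum per
    coordinate.\<close>
  also have "\<dots> = (\<Sum>a\<in>Poly_Mapping.keys f. Poly_Mapping.lookup f a *
      (\<Prod>i\<in>UNIV. \<Sum>k<d i. (\<gamma> i ^ (Poly_Mapping.lookup a i + e i)) ^ k))"
    by (subst prod_sum_PiE) (simp_all add: E_def)
  also have "\<dots> = (\<Sum>a\<in>S. Poly_Mapping.lookup f a * (\<Prod>i\<in>UNIV. of_nat (d i)))"
    unfolding prod_geo S_def by (subst sum.inter_filter) (auto intro: sum.cong)
  also have "\<dots> = (\<Sum>a\<in>S. Poly_Mapping.lookup f a) * (\<Prod>i\<in>UNIV. of_nat (d i))"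
    by (simp add: sum_distrib_right)
  \<comment> \<open>The product of the \<open>d i\<close> is nonzero in the field and
    cancels.\<close>
  finally show ?thesis
    using nz by (simp add: S_def)
qed

text \<open>The representatives of a point are the nonzero multiples of one vector. One inclusion
  has to check every scalar, the other only uses the scalar 1.\<close>

lemma vanishes_at_proj_point:
  fixes x :: "'a::field ^ 'n::finite"
  assumes "x \<noteq> 0"
  shows "vanishes_at f (proj_point x) \<longleftrightarrow>
    (\<forall>c. c \<noteq> 0 \<longrightarrow> eval_mpol (\<lambda>c. c) (\<lambda>i. c * x $ i) f = 0)"
proof -
  have "c *s x \<noteq> 0" if "c \<noteq> 0" for c
    using assms that by (simp add: vec_eq_iff)
  then have "proj_point x = (\<lambda>c. c *s x) ` {c. c \<noteq> 0}"
    using assms by (auto simp: proj_point_def proj_rel_def)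
  moreover have "($) (c *s x) = (\<lambda>i. c * x $ i)" for c
    by (simp add: fun_eq_iff)
  ultimately show ?thesis by (simp add: vanishes_at_def)
qed

text \<open>Zero coordinate sum makes each generator homogeneous. Divisibility by \<open>d i\<close>
  removes the torus parameters, so at a representative scaled by \<open>l\<close> both monomials
  take the value \<open>l ^ k\<close>.\<close>

lemma lattice_ideal_subset_vanishing_ideal:
  fixes v d :: "'n::finite \<Rightarrow> nat" and M :: "(int ^ 'n) set"
  assumes unity: "\<And>i z. z \<noteq> (0::'a::field) \<Longrightarrow> (z ^ v i) ^ d i = 1"
    and M: "\<And>c. c \<in> M \<Longrightarrow> (\<Sum>i\<in>UNIV. c $ i) = 0" "\<And>c i. c \<in> M \<Longrightarrow> int (d i) dvd c $ i"
  shows "lattice_ideal M \<subseteq> vanishing_ideal (proj_torus v :: ('a ^ 'n) set set)"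
  unfolding lattice_ideal_def vanishing_ideal_def
proof (rule ideal_gen_subset, clarify, rule ideal_gen_base, intro CollectI conjI ballI)
  fix c assume c: "c \<in> M"
  define k where "k = (\<Sum>i\<in>UNIV. nat (c $ i))"
  have "int k - int (\<Sum>i\<in>UNIV. nat (- (c $ i))) = (\<Sum>i\<in>UNIV. c $ i)"
    unfolding k_def of_nat_sum sum_subtractf[symmetric] by (intro sum.cong refl) auto
  then have k: "(\<Sum>i\<in>UNIV. nat (- (c $ i))) = k"
    using M(1)[OF c] by linarith
  let ?f = "monomial (pos_part c) - monomial (neg_part c) :: ('n, 'a) mpol"
  have "Poly_Mapping.keys ?f \<subseteq> {pos_part c, neg_part c}"
    by (auto simp: monomial_def in_keys_iff lookup_minus lookup_single when_def split: if_splits)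
  then show "homogeneous ?f"
    unfolding homogeneous_def
    by (intro exI[of _ k]) (auto simp: lookup_pos_part lookup_neg_part k k_def)
  fix p assume "p \<in> (proj_torus v :: ('a ^ 'n) set set)"
  then obtain x where x: "\<And>i. x i \<noteq> 0" and p: "p = proj_point (\<chi> i. x i ^ v i)"
    by (auto simp: proj_torus_def)
  have eval: "(\<Prod>i\<in>UNIV. (l * x i ^ v i) ^ n i) = l ^ (\<Sum>i\<in>UNIV. n i)"
    if n: "\<And>i. d i dvd n i" for l n
  proof -
    have "(x i ^ v i) ^ n i = 1" for i
      using n[of i] unity[OF x, of i i] by (auto simp: power_mult elim!: dvdE)
    then show ?thesis
      by (simp add: power_mult_distrib power_sum)
  qed
  have dvd: "d i dvd nat (c $ i)" "d i dvd nat (- (c $ i))" for i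
    using M(2)[OF c, of i] by (simp_all flip: int_dvd_int_iff)
  have "(\<chi> i. x i ^ v i) \<noteq> 0" using x by (simp add: vec_eq_iff)
  then show "vanishes_at ?f p"
    unfolding p by (simp add: vanishes_at_proj_point eval_mpol_monomial_diff lookup_pos_part
        lookup_neg_part eval dvd k flip: k_def)
qed

text \<open>Points whose parameters are powers of \<open>\<beta>\<close> suffice: the values of
  \<open>f\<close> there feed the character sums, and homogeneity gives the equal degrees.\<close>

lemma vanishing_ideal_subset_lattice_ideal:
  fixes v d :: "'n::finite \<Rightarrow> nat" and \<beta> :: "'a::field" and M :: "(int ^ 'n) set"
  assumes root: "\<And>i k. (\<beta> ^ v i) ^ k = 1 \<longleftrightarrow> d i dvd k"
    and nz: "\<And>i. of_nat (d i) \<noteq> (0::'a)" "\<beta> \<noteq> 0"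
    and M: "\<And>c. (\<Sum>i\<in>UNIV. c $ i) = 0 \<Longrightarrow> (\<And>i. int (d i) dvd c $ i) \<Longrightarrow> c \<in> M"
  shows "vanishing_ideal (proj_torus v :: ('a ^ 'n) set set) \<subseteq> lattice_ideal M"
  unfolding vanishing_ideal_def lattice_ideal_def
proof (rule ideal_gen_subset, fold lattice_ideal_def, clarify)
  fix f :: "('n, 'a) mpol"
  assume "homogeneous f" and van: "\<forall>p\<in>proj_torus v. vanishes_at f (p :: ('a ^ 'n) set)"
  then obtain k where k: "\<And>a. a \<in> Poly_Mapping.keys f \<Longrightarrow> (\<Sum>i\<in>UNIV. Poly_Mapping.lookup a i) = k"
    by (auto simp: homogeneous_def)
  have zero: "eval_mpol (\<lambda>c. c) (\<lambda>i. (\<beta> ^ v i) ^ m i) f = 0" for m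
  proof -
    define x :: "'a ^ 'n" where "x = (\<chi> i. (\<beta> ^ m i) ^ v i)"
    have "x \<noteq> 0" using nz(2) by (simp add: x_def vec_eq_iff)
    have "proj_point x \<in> proj_torus v"
      unfolding proj_torus_def x_def using nz(2)
      by (intro CollectI exI[of _ "\<lambda>i. \<beta> ^ m i"]) simp
    then have "eval_mpol (\<lambda>c. c) (\<lambda>i. 1 * x $ i) f = 0"
      using van vanishes_at_proj_point[OF \<open>x \<noteq> 0\<close>, of f] one_neq_zero by blast
    then show ?thesis
      by (simp add: x_def mult.commute flip: power_mult)
  qed
  show "f \<in> lattice_ideal M"
  proof (rule fibre_sums_zero_in_lattice_ideal[where \<phi> = "\<lambda>a i. Poly_Mapping.lookup a i mod d i"])
    fix w :: "'n \<Rightarrow> nat"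
    show "(\<Sum>a | a \<in> Poly_Mapping.keys f \<and> (\<lambda>i. Poly_Mapping.lookup a i mod d i) = w. Poly_Mapping.lookup f a) = 0"
    \<comment> \<open>A reduced \<open>w\<close> represents its own residue class; an unreduced one
      has an empty fibre.\<close>
    proof (cases "\<forall>i. w i mod d i = w i")
      case True
      then show ?thesis
        using residue_class_sums_zero[OF root nz(1) zero, of w] by (simp add: fun_eq_iff)
    next
      case False
      then have "{a. a \<in> Poly_Mapping.keys f \<and> (\<lambda>i. Poly_Mapping.lookup a i mod d i) = w} = {}" by auto
      then show ?thesis by (simp only: sum.empty)
    qed
  next
    fix a b :: "'n \<Rightarrow>\<^sub>0 nat"
    assume ab: "a \<in> Poly_Mapping.keys f" "b \<in> Poly_Mapping.keys f"
      and eq: "(\<lambda>i. Poly_Mapping.lookup a i mod d i) = (\<lambda>i. Poly_Mapping.lookup b i mod d i)"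
    show "(\<chi> i. int (Poly_Mapping.lookup a i) - int (Poly_Mapping.lookup b i)) \<in> M"
    proof (rule M)
      show "(\<Sum>i\<in>UNIV. (\<chi> i. int (Poly_Mapping.lookup a i) - int (Poly_Mapping.lookup b i)) $ i) = 0"
        using k[OF ab(1)] k[OF ab(2)] by (simp add: sum_subtractf flip: of_nat_sum)
      fix i
      show "int (d i) dvd (\<chi> i. int (Poly_Mapping.lookup a i) - int (Poly_Mapping.lookup b i)) $ i"
        using fun_cong[OF eq, of i] by (simp flip: mod_eq_dvd_iff of_nat_mod)
    qed
  qed
qed

section \<open>The unit group and the lattices\<close>

text \<open>
  \<open>units_group\<close> uses the constant \<open>mult_of\<close> of \<open>Ring_Divisibility\<close>; the library lemmas on unit
  groups of fields are about the one of \<open>Multiplicative_Group\<close>, which has the same definition.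
\<close>

lemma group_units_group: "group (units_group :: 'a::field monoid)"
  using field.field_mult_group[OF field_from_type_algebra]
  by (simp only: Ring_Divisibility.mult_of_def Multiplicative_Group.mult_of_def)

lemma carrier_units_group: "carrier (units_group :: 'a::field monoid) = - {0}"
  by (auto simp: ring_of_type_algebra_def)

lemma one_units_group: "\<one>\<^bsub>units_group\<^esub> = (1 :: 'a::field)"
  by (simp add: ring_of_type_algebra_def)

lemma mult_units_group: "x \<otimes>\<^bsub>units_group\<^esub> y = (x * y :: 'a::field)"
  by (simp add: ring_of_type_algebra_def)

lemma pow_units_group: "x [^]\<^bsub>units_group\<^esub> n = (x ^ n :: 'a::field)" for n :: nat
proof (induction n)
  case 0
  show ?case by (simp only: nat_pow_0 one_units_group power_0)
next
  case (Suc n)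
  then show ?case by (simp only: nat_pow_Suc mult_units_group power_Suc2)
qed

lemma power_eq_1_iff_ord_dvd:
  fixes z :: "'a::field"
  assumes "z \<noteq> 0"
  shows "z ^ k = 1 \<longleftrightarrow> group.ord units_group z dvd k"
  using group.pow_eq_id[OF group_units_group, of z k] assms
  by (simp add: carrier_units_group one_units_group pow_units_group del: carrier_mult_of one_mult_of)

text \<open>The order divides \<open>CARD('a) - 1\<close>, which is -1 in the field because the
  characteristic divides \<open>CARD('a)\<close>.\<close>

lemma of_nat_ord_neq_0:
  fixes z :: "'a::{field, finite}"
  assumes "z \<noteq> 0"
  shows "of_nat (group.ord units_group z) \<noteq> (0 :: 'a)"
proof
  assume *: "of_nat (group.ord units_group z) = (0 :: 'a)"
  have "z \<in> carrier units_group"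
    using assms by (simp only: carrier_units_group) simp
  then have "group.ord units_group z dvd Coset.order (units_group :: 'a monoid)"
    by (rule group.ord_dvd_group_order[OF group_units_group])
  also have "Coset.order (units_group :: 'a monoid) = CARD('a) - 1"
    unfolding Coset.order_def carrier_units_group by (simp add: card_Diff_singleton Compl_eq_Diff_UNIV)
  finally have "of_nat (CARD('a) - 1) = (0 :: 'a)"
    using * by (metis dvdE mult_zero_left of_nat_mult)
  moreover have "of_nat CARD('a) = (0 :: 'a)"
    using CHAR_dvd_CARD of_nat_eq_0_iff_char_dvd by blast
  ultimately show False
    by (simp add: of_nat_diff Suc_leI)
qed

text \<open>The elements whose \<open>k\<close>-th power is 1 form a subgroup; once it contains the
  generator it is the whole unit group.\<close>

lemma generator_power_eq_1:
  fixes \<beta> z :: "'a::field"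
  assumes "generate units_group {\<beta>} = carrier units_group" "\<beta> \<noteq> 0" "\<beta> ^ k = 1" "z \<noteq> 0"
  shows "z ^ k = 1"
proof -
  interpret group "units_group :: 'a monoid" by (rule group_units_group)
  have \<beta>: "\<beta> \<in> carrier units_group"
    using assms(2) by (simp only: carrier_units_group) simp
  have "z \<in> generate units_group {\<beta>}"
    using assms(1,4) carrier_units_group by auto
  then show ?thesis
  proof induction
    case one
    show ?case by (simp only: one_units_group power_one)
  next
    case (incl h)
    then show ?case using assms(3) by simp
  next
    case (inv h)
    have "inv\<^bsub>units_group\<^esub> \<beta> * \<beta> = 1"
      using l_inv[OF \<beta>] by (simp only: mult_units_group one_units_group)
    then have "(inv\<^bsub>units_group\<^esub> \<beta>) ^ k * \<beta> ^ k = 1"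
      by (simp flip: power_mult_distrib)
    then show ?case using inv assms(3) by simp
  next
    case (eng h1 h2)
    then show ?case by (simp only: mult_units_group power_mult_distrib mult_1)
  qed
qed

lemma additive_int: "Modules.additive g \<Longrightarrow> g k = k * g 1" for g :: "int \<Rightarrow> int"
proof (induction k rule: int_induct[where k = 0])
  case base
  then show ?case by (simp add: additive.zero)
next
  case (step1 k)
  then show ?case by (simp add: additive.add algebra_simps)
next
  case (step2 k)
  then show ?case by (simp add: additive.diff algebra_simps)
qed

text \<open>Turns maps known only by additivity and their values on the basis, as
  \<open>\<psi>\<close> and \<open>D\<close> are, into explicit formulas.\<close>

lemma additive_vec:
  fixes g :: "int ^ 'n::finite \<Rightarrow> int"
  assumes "Modules.additive g"
  shows "g c = (\<Sum>i\<in>UNIV. c $ i * g (axis i 1))"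
proof -
  interpret g: Modules.additive g by fact
  have lin: "g (axis i k) = k * g (axis i 1)" for i k
  proof (rule additive_int[of "\<lambda>k. g (axis i k)"], unfold_locales)
    fix x y :: int
    have "axis i (x + y) = axis i x + axis i y" by (simp add: vec_eq_iff axis_def)
    then show "g (axis i (x + y)) = g (axis i x) + g (axis i y)" by (simp add: g.add)
  qed
  have "c = (\<Sum>i\<in>UNIV. axis i (c $ i))"
    by (simp add: vec_eq_iff axis_def)
  then have "g c = (\<Sum>i\<in>UNIV. g (axis i (c $ i)))"
    by (metis g.sum)
  also have "\<dots> = (\<Sum>i\<in>UNIV. c $ i * g (axis i 1))"
    by (intro sum.cong refl lin)
  finally show ?thesis .
qed

theorem proposition3p2:
  fixes v d :: "'n::finite \<Rightarrow> nat"
    and \<beta> :: "'a::{field, finite}"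
    and \<psi> :: "int ^ 'n \<Rightarrow> int"
    and D :: "int ^ 'n \<Rightarrow> int ^ 'n"
  assumes "\<And>i. v i > 0"
    and "\<beta> \<in> carrier units_group" and "generate units_group {\<beta>} = carrier units_group"
    and "\<And>i. d i = group.ord units_group (\<beta> ^ v i)"
    and "Modules.additive \<psi>" and "\<And>i. \<psi> (axis i 1) = int (d i)"
    and "Modules.additive D" and "\<And>i. D (axis i 1) = axis i (int (d i))"
  shows "(toric_ideal d :: ('n, 'a) mpol set) = lattice_ideal {c. \<psi> c = 0}
    \<and> vanishing_ideal (proj_torus v :: ('a ^ 'n) set set) = lattice_ideal (D ` {c. \<psi> c = 0})"
proof -
  have \<beta>: "\<beta> \<noteq> 0" using assms(2) by (simp only: carrier_units_group) simp
  have root: "(\<beta> ^ v i) ^ k = 1 \<longleftrightarrow> d i dvd k" for i k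
    using \<beta> by (simp add: power_eq_1_iff_ord_dvd assms(4))
  have nz: "of_nat (d i) \<noteq> (0 :: 'a)" for i
    using \<beta> by (simp add: of_nat_ord_neq_0 assms(4))
  \<comment> \<open>\<open>\<beta>\<close> has trivial power \<open>v i * d i\<close>, and this
    passes to every unit.\<close>
  have unity: "(z ^ v i) ^ d i = 1" if "z \<noteq> 0" for i and z :: 'a
    using generator_power_eq_1[OF assms(3) \<beta> _ that, of "v i * d i"] root[of i "d i"]
    by (simp add: power_mult)
  have \<psi>: "\<psi> c = (\<Sum>i\<in>UNIV. c $ i * int (d i))" for c
    using additive_vec[OF assms(5)] by (simp add: assms(6))
  have D: "D c $ j = c $ j * int (d j)" for c j
  proof -
    have "D c $ j = (\<Sum>i\<in>UNIV. c $ i * D (axis i 1) $ j)"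
      by (rule additive_vec[of "\<lambda>c. D c $ j"], unfold_locales) (simp add: additive.add[OF assms(7)])
    also have "\<dots> = (\<Sum>i\<in>UNIV. if i = j then c $ j * int (d j) else 0)"
      unfolding assms(8) by (intro sum.cong refl) (simp add: axis_def)
    finally show ?thesis by simp
  qed
  \<comment> \<open>\<open>\<psi> c\<close> is the coordinate sum of \<open>D c\<close>, so the
    image of the kernel consists of the vectors with zero sum and \<open>i\<close>-th coordinate
    divisible by \<open>d i\<close>; a preimage is found by coordinatewise division.\<close>
  have mem: "c \<in> D ` {c. \<psi> c = 0}"
    if "(\<Sum>i\<in>UNIV. c $ i) = 0" "\<And>i. int (d i) dvd c $ i" for c :: "int ^ 'n"
  proof
    show "c = D (\<chi> i. c $ i div int (d i))"
      using that(2) by (simp add: vec_eq_iff D)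
    show "(\<chi> i. c $ i div int (d i)) \<in> {c. \<psi> c = 0}"
      using that by (simp add: \<psi>)
  qed
  show ?thesis
  proof (intro conjI equalityI)
    show "(toric_ideal d :: ('n, 'a) mpol set) \<subseteq> lattice_ideal {c. \<psi> c = 0}"
      by (rule toric_ideal_subset_lattice_ideal) (simp add: \<psi>)
    show "lattice_ideal {c. \<psi> c = 0} \<subseteq> (toric_ideal d :: ('n, 'a) mpol set)"
      by (rule lattice_ideal_subset_toric_ideal) (simp add: \<psi>)
    show "vanishing_ideal (proj_torus v :: ('a ^ 'n) set set) \<subseteq> lattice_ideal (D ` {c. \<psi> c = 0})"
      by (rule vanishing_ideal_subset_lattice_ideal[OF root nz \<beta> mem])
    show "lattice_ideal (D ` {c. \<psi> c = 0}) \<subseteq> vanishing_ideal (proj_torus v :: ('a ^ 'n) set set)"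
      by (rule lattice_ideal_subset_vanishing_ideal[OF unity]) (auto simp: \<psi> D)
  qed
qed

end
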